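(* For every integer $k\ge 1$, $3\le \chi_{la}(kC(8,2))\le 4$.
   Context: For a graph $G=(V,E)$ with $|E|=m$ and no isolated vertices, a local antimagic labeling is a bijection $f:E\to\{1,\dots,m\}$ such that $f^+(u)\ne f^+(v)$ for every edge $uv$, where $f^+(x)=\sum f(e)$ over all edges $e$ incident to $x$. The local antimagic chromatic number $\chi_{la}(G)$ is the minimum, over all local antimagic labelings $f$ of $G$, of the number of distinct values taken by $f^+$ (also for disconnected graphs). $kG$ is the disjoint union of $k$ copies of $G$. Let $C_8^*$ be the graph consisting of an 8-cycle $u_1u_2\cdots u_8u_1$ together with an additional vertex $x$ adjacent to $u_2$ and $u_6$. $C(8,2)$ is obtained from $C_8^*$ by merging $x$ and $u_8$ into a single vertex $z$ (so $C(8,2)$ is the 8-cycle $u_1\cdots u_8u_1$ with the extra edges $u_8u_2$ and $u_8u_6$, and $z=u_8$ has degree 4). *)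

theory Defs
  imports Main "HOL-Library.Extended_Nat"
begin

text \<open>Simple undirected graphs: edges are two-element sets of vertices.\<close>

record 'a ugraph =
  verts :: "'a set"
  edges :: "'a set set"

definition finite_simple_graph :: "'a ugraph \<Rightarrow> bool" where
  "finite_simple_graph G \<longleftrightarrow>
     finite (verts G) \<and> (\<forall>e\<in>edges G. e \<subseteq> verts G \<and> card e = 2)"

definition no_isolated_vertices :: "'a ugraph \<Rightarrow> bool" where
  "no_isolated_vertices G \<longleftrightarrow> (\<forall>v\<in>verts G. \<exists>e\<in>edges G. v \<in> e)"

definition vertex_label :: "'a ugraph \<Rightarrow> ('a set \<Rightarrow> nat) \<Rightarrow> 'a \<Rightarrow> nat" where
  "vertex_label G f x = (\<Sum>e\<in>{e \<in> edges G. x \<in> e}. f e)"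

definition local_antimagic_labeling :: "'a ugraph \<Rightarrow> ('a set \<Rightarrow> nat) \<Rightarrow> bool" where
  "local_antimagic_labeling G f \<longleftrightarrow>
     bij_betw f (edges G) {1..card (edges G)} \<and>
     (\<forall>u v. {u, v} \<in> edges G \<longrightarrow> vertex_label G f u \<noteq> vertex_label G f v)"

text \<open>
  The notion is meant for finite simple graphs without isolated vertices. The value is
  \<open>\<infinity>\<close> exactly if there is no local antimagic labeling; otherwise the infimum is
  a minimum.
\<close>

definition chi_la :: "'a ugraph \<Rightarrow> enat" where
  "chi_la G = (INF f \<in> {f. local_antimagic_labeling G f}.
                 enat (card (vertex_label G f ` verts G)))"

definition copies :: "nat \<Rightarrow> 'a ugraph \<Rightarrow> (nat \<times> 'a) ugraph" where
  "copies k G =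
     \<lparr> verts = {..<k} \<times> verts G,
       edges = {Pair i ` e | i e. i < k \<and> e \<in> edges G} \<rparr>"

text \<open>Merging \<open>a\<close> into \<open>b\<close>; the merged vertex keeps the name \<open>b\<close>.\<close>

definition merge :: "'a \<Rightarrow> 'a \<Rightarrow> 'a ugraph \<Rightarrow> 'a ugraph" where
  "merge a b G =
     (let h = (\<lambda>v. if v = a then b else v)
      in \<lparr> verts = h ` verts G, edges = (\<lambda>e. h ` e) ` edges G \<rparr>)"

datatype vertex = U nat | X

definition C8_star :: "vertex ugraph" where
  "C8_star =
     \<lparr> verts = U ` {1..8} \<union> {X},
       edges = (\<lambda>i. {U i, U (i + 1)}) ` {1..7} \<union> {{U 8, U 1}, {X, U 2}, {X, U 6}} \<rparr>"

definition C8_2 :: "vertex ugraph" where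
  "C8_2 = merge X (U 8) C8_star"

lemma verts_C8_2: "verts C8_2 = {U 1, U 2, U 3, U 4, U 5, U 6, U 7, U 8}"
proof -
  have "{1..8::nat} = {1, 2, 3, 4, 5, 6, 7, 8}" by auto
  then show ?thesis by (auto simp: C8_2_def C8_star_def merge_def)
qed

lemma edges_C8_2:
  "edges C8_2 =
     {{U 1, U 2}, {U 2, U 3}, {U 3, U 4}, {U 4, U 5}, {U 5, U 6}, {U 6, U 7},
      {U 7, U 8}, {U 8, U 1}, {U 8, U 2}, {U 8, U 6}}"
proof -
  have "{1..7::nat} = {1, 2, 3, 4, 5, 6, 7}" by auto
  then have "(\<lambda>i::nat. {U i, U (i + 1)}) ` {1..7} =
     {{U 1, U 2}, {U 2, U 3}, {U 3, U 4}, {U 4, U 5}, {U 5, U 6}, {U 6, U 7}, {U 7, U 8}}"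
    by (simp add: numeral_eq_Suc)
  then have "edges C8_star =
     {{U 1, U 2}, {U 2, U 3}, {U 3, U 4}, {U 4, U 5}, {U 5, U 6}, {U 6, U 7},
      {U 7, U 8}, {U 8, U 1}, {X, U 2}, {X, U 6}}"
    unfolding C8_star_def ugraph.simps by (simp only: Un_insert_left Un_empty_left)
  then show ?thesis by (simp add: C8_2_def merge_def Let_def)
qed

lemma card_edges_C8_2: "card (edges C8_2) = 10"
proof -
  let ?xs = "[{U 1, U 2}, {U 2, U 3}, {U 3, U 4}, {U 4, U 5}, {U 5, U 6}, {U 6, U 7},
      {U 7, U 8}, {U 8, U 1}, {U 8, U 2}, {U 8, U 6}]"
  have "distinct ?xs"
    by (simp only: distinct.simps list.set insert_iff empty_iff doubleton_eq_iff vertex.inject) simp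
  then have "card (set ?xs) = length ?xs" by (rule distinct_card)
  then show ?thesis unfolding edges_C8_2 list.set list.size by simp
qed

lemma copies_C8_2_graph:
  "finite_simple_graph (copies k C8_2)" "no_isolated_vertices (copies k C8_2)"
proof -
  have "card (Pair i ` e) = card e" for i :: nat and e :: "vertex set"
    by (simp add: card_image inj_on_def)
  moreover have "e \<subseteq> verts C8_2 \<and> card e = 2" if "e \<in> edges C8_2" for e
    using that unfolding edges_C8_2 verts_C8_2 by auto
  moreover have "finite (verts C8_2)" by (simp add: verts_C8_2)
  ultimately show "finite_simple_graph (copies k C8_2)"
    unfolding finite_simple_graph_def copies_def by fastforce
  have "\<exists>e\<in>edges C8_2. v \<in> e" if "v \<in> verts C8_2" for v
    using that unfolding edges_C8_2 verts_C8_2 by auto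
  note cover = this
  show "no_isolated_vertices (copies k C8_2)"
    unfolding no_isolated_vertices_def
  proof
    fix p
    assume "p \<in> verts (copies k C8_2)"
    then obtain i v where p: "p = (i, v)" "i < k" "v \<in> verts C8_2"
      by (auto simp: copies_def)
    from cover[OF p(3)] obtain e where e: "e \<in> edges C8_2" "v \<in> e" ..
    have "Pair i ` e \<in> edges (copies k C8_2)" using p e by (auto simp: copies_def)
    moreover have "p \<in> Pair i ` e" using p e by simp
    ultimately show "\<exists>e\<in>edges (copies k C8_2). p \<in> e" ..
  qed
qed

end

theory Submission imports Defs begin

text \<open>
  The triangle on \<open>u\<^sub>1\<close>, \<open>u\<^sub>2\<close>, \<open>u\<^sub>8\<close> forces three colours. For the upper bound, the labels
  \<open>1..8k\<close> are cut into eight blocks of length \<open>k\<close>, one for each edge of the 8-cycle; copy \<open>i\<close>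
  takes its label at position \<open>i\<close> of the block, counted from the left or from the right. The two
  chords share \<open>8k+1..10k\<close> by parity and run with slopes \<open>-2\<close> and \<open>2\<close>. The slopes cancel at each
  vertex, so the vertex sums do not depend on \<open>i\<close>; the order of the blocks was found by a computer
  search so that only the values \<open>8k+1\<close>, \<open>13k+1\<close>, \<open>13k+2\<close>, \<open>29k+2\<close> occur.
\<close>

text \<open>Otherwise the simplifier turns the vertex \<open>U 1\<close> into \<open>U (Suc 0)\<close>.\<close>

declare One_nat_def [simp del]

section \<open>Bounds on the local antimagic chromatic number\<close>

lemma chi_la_le:
  assumes "local_antimagic_labeling G f"
  shows "chi_la G \<le> enat (card (vertex_label G f ` verts G))"
  unfolding chi_la_def using assms by (intro INF_lower) simp

lemma triangle_chi_la_ge_3: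
  assumes G: "finite_simple_graph G"
    and tri: "{a, b} \<in> edges G" "{b, c} \<in> edges G" "{a, c} \<in> edges G"
  shows "3 \<le> chi_la G"
  unfolding chi_la_def
\<comment> \<open>A bound valid for each labeling separately passes to the infimum, also when there
  is no labeling and the value is infinite.\<close>
proof (rule INF_greatest)
  fix f assume "f \<in> {f. local_antimagic_labeling G f}"
  then have ne: "vertex_label G f u \<noteq> vertex_label G f v" if "{u, v} \<in> edges G" for u v
    using that unfolding local_antimagic_labeling_def by simp
  have "{a, b, c} \<subseteq> verts G" "finite (verts G)"
    using G tri unfolding finite_simple_graph_def by auto
  then have "card (vertex_label G f ` {a, b, c}) \<le> card (vertex_label G f ` verts G)"
    by (intro card_mono image_mono finite_imageI)
  moreover have "card (vertex_label G f ` {a, b, c}) = 3"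
    using tri[THEN ne] by simp
  ultimately show "3 \<le> enat (card (vertex_label G f ` verts G))"
    by (simp add: numeral_eq_enat)
qed

section \<open>Edges and vertex sums in disjoint copies\<close>

lemma inj_image_Pair: "inj ((`) (Pair i))"
  by (intro inj_onI) (simp add: inj_image_eq_iff inj_on_def)

text \<open>An empty set would have the same image in every copy; a nonempty one retains the index
  \<open>i\<close>.\<close>

lemma Pair_image_eq_iff:
  assumes "e \<noteq> {}"
  shows "Pair i ` e = Pair j ` e' \<longleftrightarrow> i = j \<and> e = e'"
proof
  assume eq: "Pair i ` e = Pair j ` e'"
  have "i = j" using eq assms by blast
  with eq show "i = j \<and> e = e'" using inj_image_Pair by (metis injD)
qed simp

lemma edge_nonempty: "finite_simple_graph G \<Longrightarrow> e \<in> edges G \<Longrightarrow> e \<noteq> {}"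
  unfolding finite_simple_graph_def by auto

lemma card_edges_copies:
  assumes G: "finite_simple_graph G"
  shows "card (edges (copies k G)) = k * card (edges G)"
proof -
  have "edges (copies k G) = (\<lambda>(i, e). Pair i ` e) ` ({..<k} \<times> edges G)"
    by (auto simp: copies_def)
  moreover have "inj_on (\<lambda>(i, e). Pair i ` e) ({..<k} \<times> edges G)"
    using edge_nonempty[OF G] by (auto simp: inj_on_def Pair_image_eq_iff)
  ultimately show ?thesis by (simp add: card_image card_cartesian_product)
qed

lemma vertex_label_copies:
  assumes "i < k"
  shows "vertex_label (copies k G) f (i, v) = vertex_label G (\<lambda>e. f (Pair i ` e)) v"
proof -
  have "{e \<in> edges (copies k G). (i, v) \<in> e} = (`) (Pair i) ` {e \<in> edges G. v \<in> e}"
    using assms by (auto simp: copies_def)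
  moreover have "inj_on ((`) (Pair i)) {e \<in> edges G. v \<in> e}"
    using inj_image_Pair by (rule inj_on_subset) simp
  ultimately show ?thesis
    unfolding vertex_label_def by (simp add: sum.reindex)
qed

text \<open>All vertices of an edge of \<open>copies k G\<close> carry the same first component, so
  \<open>fst\<close> maps the edge to a singleton and \<open>the_elem\<close> reads off its
  copy.\<close>

definition copy_index :: "(nat \<times> 'a) set \<Rightarrow> nat" where
  "copy_index e = the_elem (fst ` e)"

lemma copy_index_Pair_image: "e \<noteq> {} \<Longrightarrow> copy_index (Pair i ` e) = i"
  by (simp add: copy_index_def image_image image_constant_conv)

section \<open>Labels on one copy of the graph\<close>

lemma finite_simple_graph_C8_2: "finite_simple_graph C8_2"
  unfolding finite_simple_graph_def edges_C8_2 verts_C8_2 by auto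

text \<open>For an explicitly listed edge set, this form can be evaluated edge by edge, with no set
  of incident edges to compute first.\<close>

lemma vertex_label_eq_sum_if:
  "finite (edges G) \<Longrightarrow> vertex_label G f v = (\<Sum>e\<in>edges G. if v \<in> e then f e else 0)"
  unfolding vertex_label_def by (rule sum.inter_filter)

lemma vertex_label_C8_2:
  "vertex_label C8_2 f (U 1) = f {U 1, U 2} + f {U 8, U 1}"
  "vertex_label C8_2 f (U 2) = f {U 1, U 2} + f {U 2, U 3} + f {U 8, U 2}"
  "vertex_label C8_2 f (U 3) = f {U 2, U 3} + f {U 3, U 4}"
  "vertex_label C8_2 f (U 4) = f {U 3, U 4} + f {U 4, U 5}"
  "vertex_label C8_2 f (U 5) = f {U 4, U 5} + f {U 5, U 6}"
  "vertex_label C8_2 f (U 6) = f {U 5, U 6} + f {U 6, U 7} + f {U 8, U 6}"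
  "vertex_label C8_2 f (U 7) = f {U 6, U 7} + f {U 7, U 8}"
  "vertex_label C8_2 f (U 8) = f {U 7, U 8} + f {U 8, U 1} + f {U 8, U 2} + f {U 8, U 6}"
  by (simp_all add: vertex_label_eq_sum_if edges_C8_2 doubleton_eq_iff)

text \<open>Starting from \<open>{U 1, U 2}\<close>, the cycle edges use blocks 2, 3, 6, 8, 1, 4, 5,
  7 with slopes +, +, -, +, -, -, +, -. The chord \<open>{U 8, U 2}\<close> takes the even labels
  and offsets two rising edges at \<open>U 2\<close>; the chord \<open>{U 8, U 6}\<close>, left to
  the last branch, takes the odd ones and offsets two falling edges at \<open>U 6\<close>.\<close>

definition C8_2_label :: "nat \<Rightarrow> nat \<Rightarrow> vertex set \<Rightarrow> nat" where
  "C8_2_label k i e =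
     (if e = {U 1, U 2} then k + i + 1
      else if e = {U 2, U 3} then 2 * k + i + 1
      else if e = {U 3, U 4} then 6 * k - i
      else if e = {U 4, U 5} then 7 * k + i + 1
      else if e = {U 5, U 6} then k - i
      else if e = {U 6, U 7} then 4 * k - i
      else if e = {U 7, U 8} then 4 * k + i + 1
      else if e = {U 8, U 1} then 7 * k - i
      else if e = {U 8, U 2} then 10 * k - 2 * i
      else 8 * k + 2 * i + 1)"

lemma C8_2_label_simps:
  "C8_2_label k i {U 1, U 2} = k + i + 1"
  "C8_2_label k i {U 2, U 3} = 2 * k + i + 1"
  "C8_2_label k i {U 3, U 4} = 6 * k - i"
  "C8_2_label k i {U 4, U 5} = 7 * k + i + 1"
  "C8_2_label k i {U 5, U 6} = k - i"
  "C8_2_label k i {U 6, U 7} = 4 * k - i"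
  "C8_2_label k i {U 7, U 8} = 4 * k + i + 1"
  "C8_2_label k i {U 8, U 1} = 7 * k - i"
  "C8_2_label k i {U 8, U 2} = 10 * k - 2 * i"
  "C8_2_label k i {U 8, U 6} = 8 * k + 2 * i + 1"
  by (simp_all add: C8_2_label_def doubleton_eq_iff)

lemma vertex_label_C8_2_label:
  assumes "i < k"
  shows "vertex_label C8_2 (C8_2_label k i) (U 1) = 8 * k + 1"
    "vertex_label C8_2 (C8_2_label k i) (U 2) = 13 * k + 2"
    "vertex_label C8_2 (C8_2_label k i) (U 3) = 8 * k + 1"
    "vertex_label C8_2 (C8_2_label k i) (U 4) = 13 * k + 1"
    "vertex_label C8_2 (C8_2_label k i) (U 5) = 8 * k + 1"
    "vertex_label C8_2 (C8_2_label k i) (U 6) = 13 * k + 1"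
    "vertex_label C8_2 (C8_2_label k i) (U 7) = 8 * k + 1"
    "vertex_label C8_2 (C8_2_label k i) (U 8) = 29 * k + 2"
  \<comment> \<open>Since \<open>i < k\<close>, no subtraction on the naturals is truncated.\<close>
  using assms unfolding vertex_label_C8_2 C8_2_label_simps by linarith+

lemma C8_2_label_surj:
  assumes n: "n \<in> {1..10 * k}"
  shows "\<exists>i<k. \<exists>e\<in>edges C8_2. C8_2_label k i e = n"
proof -
  have witness: "\<exists>i<k. \<exists>e\<in>edges C8_2. C8_2_label k i e = n"
    if "i < k" "e \<in> edges C8_2" "C8_2_label k i e = n" for i e
    using that by blast
  \<comment> \<open>Up to \<open>8 * k\<close> the block determines the edge; beyond that, parity
    separates the chords. Each witness below solves the formula of its edge for
    \<open>i\<close>.\<close>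
  consider "n \<le> k" | "k < n" "n \<le> 2 * k" | "2 * k < n" "n \<le> 3 * k" | "3 * k < n" "n \<le> 4 * k"
    | "4 * k < n" "n \<le> 5 * k" | "5 * k < n" "n \<le> 6 * k" | "6 * k < n" "n \<le> 7 * k"
    | "7 * k < n" "n \<le> 8 * k" | "8 * k < n" "even n" | "8 * k < n" "odd n"
    by (meson not_le)
  then show ?thesis
  proof cases
    case 1
    show ?thesis
      by (rule witness[of "k - n" "{U 5, U 6}"])
        (use 1 n in \<open>auto simp: C8_2_label_simps edges_C8_2\<close>)
  next
    case 2
    show ?thesis
      by (rule witness[of "n - k - 1" "{U 1, U 2}"])
        (use 2 n in \<open>auto simp: C8_2_label_simps edges_C8_2\<close>)
  next
    case 3
    show ?thesis
      by (rule witness[of "n - 2 * k - 1" "{U 2, U 3}"])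
        (use 3 n in \<open>auto simp: C8_2_label_simps edges_C8_2\<close>)
  next
    case 4
    show ?thesis
      by (rule witness[of "4 * k - n" "{U 6, U 7}"])
        (use 4 n in \<open>auto simp: C8_2_label_simps edges_C8_2\<close>)
  next
    case 5
    show ?thesis
      by (rule witness[of "n - 4 * k - 1" "{U 7, U 8}"])
        (use 5 n in \<open>auto simp: C8_2_label_simps edges_C8_2\<close>)
  next
    case 6
    show ?thesis
      by (rule witness[of "6 * k - n" "{U 3, U 4}"])
        (use 6 n in \<open>auto simp: C8_2_label_simps edges_C8_2\<close>)
  next
    case 7
    show ?thesis
      by (rule witness[of "7 * k - n" "{U 8, U 1}"])
        (use 7 n in \<open>auto simp: C8_2_label_simps edges_C8_2\<close>)
  next
    case 8
    show ?thesis
      by (rule witness[of "n - 7 * k - 1" "{U 4, U 5}"])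
        (use 8 n in \<open>auto simp: C8_2_label_simps edges_C8_2\<close>)
  next
    case 9
    then obtain m where m: "n = 2 * m" by (elim evenE)
    show ?thesis
      by (rule witness[of "5 * k - m" "{U 8, U 2}"])
        (use 9 m n in \<open>auto simp: C8_2_label_simps edges_C8_2\<close>)
  next
    case 10
    then obtain m where m: "n = 2 * m + 1" by (elim oddE)
    show ?thesis
      by (rule witness[of "m - 4 * k" "{U 8, U 6}"])
        (use 10 m n in \<open>auto simp: C8_2_label_simps edges_C8_2\<close>)
  qed
qed

section \<open>The labeling of the disjoint union\<close>

definition copies_label :: "nat \<Rightarrow> (nat \<times> vertex) set \<Rightarrow> nat" where
  "copies_label k e = C8_2_label k (copy_index e) (snd ` e)"

lemma copies_label_Pair_image:
  assumes "e \<in> edges C8_2"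
  shows "copies_label k (Pair i ` e) = C8_2_label k i e"
proof -
  have "e \<noteq> {}" using assms edge_nonempty finite_simple_graph_C8_2 by blast
  then show ?thesis by (simp add: copies_label_def copy_index_Pair_image image_image)
qed

lemma vertex_label_copies_label:
  assumes "i < k"
  shows "vertex_label (copies k C8_2) (copies_label k) (i, v)
    = vertex_label C8_2 (C8_2_label k i) v"
  unfolding vertex_label_copies[OF assms] unfolding vertex_label_def
  by (intro sum.cong) (simp_all add: copies_label_Pair_image)

text \<open>There are \<open>10 * k\<close> edges, so once all \<open>10 * k\<close> labels occur,
  counting shows that no other value occurs and none is repeated.\<close>

lemma bij_betw_copies_label:
  "bij_betw (copies_label k) (edges (copies k C8_2)) {1..card (edges (copies k C8_2))}"
proof -
  let ?E = "edges (copies k C8_2)"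
  have card: "card ?E = 10 * k"
    by (simp add: card_edges_copies finite_simple_graph_C8_2 card_edges_C8_2)
  have fin: "finite ?E"
  proof (rule finite_subset)
    show "?E \<subseteq> Pow (verts (copies k C8_2))" "finite (Pow (verts (copies k C8_2)))"
      using copies_C8_2_graph(1)[of k] unfolding finite_simple_graph_def by auto
  qed
  have sub: "{1..10 * k} \<subseteq> copies_label k ` ?E"
  proof
    fix n assume "n \<in> {1..10 * k}"
    then obtain i e where "i < k" "e \<in> edges C8_2" "C8_2_label k i e = n"
      using C8_2_label_surj by blast
    then have "Pair i ` e \<in> ?E" "copies_label k (Pair i ` e) = n"
      by (auto simp: copies_def copies_label_Pair_image)
    then show "n \<in> copies_label k ` ?E" by blast
  qed
  have img: "{1..10 * k} = copies_label k ` ?E"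
    using fin sub by (rule card_seteq[OF finite_imageI]) (use card_image_le[OF fin] card in simp)
  then have "inj_on (copies_label k) ?E"
    using fin card by (intro eq_card_imp_inj_on) (simp_all flip: img)
  then show ?thesis using img card by (simp add: bij_betw_def)
qed

text \<open>Cycle edges join an odd vertex, with sum \<open>8 * k + 1\<close>, to an even one, whose
  sum is larger because \<open>k > 0\<close>. The chords meet at \<open>U 8\<close>, the only vertex
  with sum \<open>29 * k + 2\<close>.\<close>

lemma edge_C8_2_vertex_label_neq:
  assumes "i < k" "{u, v} \<in> edges C8_2"
  shows "vertex_label C8_2 (C8_2_label k i) u \<noteq> vertex_label C8_2 (C8_2_label k i) v"
  using assms unfolding edges_C8_2
  by (auto simp: doubleton_eq_iff vertex_label_C8_2_label)

lemma local_antimagic_copies_label: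
  "local_antimagic_labeling (copies k C8_2) (copies_label k)"
  unfolding local_antimagic_labeling_def
proof (intro conjI allI impI bij_betw_copies_label)
  fix p q assume "{p, q} \<in> edges (copies k C8_2)"
  then obtain i e where e: "{p, q} = Pair i ` e" "i < k" "e \<in> edges C8_2"
    by (auto simp: copies_def)
  then have "p \<in> Pair i ` e" "q \<in> Pair i ` e" by blast+
  then obtain u v where pq: "p = (i, u)" "q = (i, v)" by blast
  \<comment> \<open>Dropping the copy index recovers the edge of \<open>C8_2\<close>.\<close>
  have "snd ` {p, q} = snd ` Pair i ` e" using e(1) by (rule arg_cong)
  then have "e = {u, v}" by (simp add: pq image_image)
  then show "vertex_label (copies k C8_2) (copies_label k) p
      \<noteq> vertex_label (copies k C8_2) (copies_label k) q"
    using e edge_C8_2_vertex_label_neq by (simp add: pq vertex_label_copies_label)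
qed

theorem theorem4p4:
  fixes k :: nat
  assumes "k \<ge> 1"
  shows "3 \<le> chi_la (copies k C8_2) \<and> chi_la (copies k C8_2) \<le> 4"
proof
  \<comment> \<open>Copy 0 exists because \<open>k \<ge> 1\<close>; its triangle gives the lower
    bound.\<close>
  have copy: "{(0, a), (0, b)} \<in> edges (copies k C8_2)" if "{a, b} \<in> edges C8_2" for a b
  proof -
    have "0 < k" using assms by simp
    with that have "Pair 0 ` {a, b} \<in> edges (copies k C8_2)"
      unfolding copies_def ugraph.simps by blast
    then show ?thesis by simp
  qed
  show "3 \<le> chi_la (copies k C8_2)"
    by (rule triangle_chi_la_ge_3[OF copies_C8_2_graph(1), of "(0, U 8)" "(0, U 1)" _ "(0, U 2)"])
      (rule copy; simp add: edges_C8_2)+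
  let ?vl = "vertex_label (copies k C8_2) (copies_label k)"
  have "?vl ` verts (copies k C8_2) \<subseteq> {8 * k + 1, 13 * k + 1, 13 * k + 2, 29 * k + 2}"
  proof
    fix n assume "n \<in> ?vl ` verts (copies k C8_2)"
    then obtain i v where "i < k" "v \<in> verts C8_2" "n = ?vl (i, v)"
      unfolding copies_def ugraph.simps by blast
    then show "n \<in> {8 * k + 1, 13 * k + 1, 13 * k + 2, 29 * k + 2}"
      unfolding verts_C8_2 by (auto simp: vertex_label_copies_label vertex_label_C8_2_label)
  qed
  then have "card (?vl ` verts (copies k C8_2))
      \<le> card {8 * k + 1, 13 * k + 1, 13 * k + 2, 29 * k + 2}"
    by (rule card_mono[rotated]) simp
  also have "\<dots> \<le> 4" by (simp add: card_insert_if)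
  finally have "enat (card (?vl ` verts (copies k C8_2))) \<le> 4"
    by (simp add: numeral_eq_enat)
  with chi_la_le[OF local_antimagic_copies_label] show "chi_la (copies k C8_2) \<le> 4"
    by (rule order_trans)
qed

end
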